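(* Let $\mathcal S$ denote the set of all Göllnitz-Gordon partitions $\pi$ such that every even part $b$ of $\pi$ satisfies $$b\equiv 2t(b;\pi)\pmod 4 .$$ Decompose each $\pi\in\mathcal S$ into chains $\chi$, and define the weight of a chain $\chi$ of $\pi$ by $$\omega(\chi)=\begin{cases}2,&\text{if }\chi\text{ is an odd chain, }\lambda(\chi)\ge 5,\text{ and }\lambda(\chi)\equiv 1+2t(\lambda(\chi);\pi)\pmod 4,\\ 1,&\text{otherwise.}\end{cases}$$ Define the weight of $\pi$ by $\omega(\pi)=\prod_{\chi}\omega(\chi)$, the product being over all chains $\chi$ of $\pi$. Then for every nonnegative integer $n$, $$Q_2(n)=\sum_{\pi\in\mathcal S,\ \sigma(\pi)=n}\omega(\pi).$$
   Context: $Q_2(n)$ denotes the number of partitions of $n$ into distinct parts $\not\equiv 2\pmod 4$. A Göllnitz-Gordon partition is a partition into parts differing by at least $2$, where the inequality is strict if a part is even (i.e. any two consecutive parts differ by at least $2$, and by more than $2$ if either of them is even). For a partition $\pi$ into parts differing by $\ge 2$, a chain $\chi$ in $\pi$ is a maximal string of parts of $\pi$ in which consecutive ones differ by exactly $2$; every such $\pi$ decomposes uniquely into chains. All parts of a chain have the same parity modulo $2$, and the chain is called odd (resp. even) if its parts are odd (resp. even). $\lambda(\chi)$ is the least part of the chain $\chi$. For a part $b$ of $\pi$, $t(b;\pi)$ is the number of odd parts of $\pi$ that are $<b$. $\sigma(\pi)$ is the sum of the parts of $\pi$. The empty partition is the unique partition of $0$; an empty product equals $1$. *)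

theory Defs
  imports Main "HOL-Number_Theory.Cong"
begin

text \<open>
  All partitions considered here have distinct parts, so a partition is represented by
  the finite set of its (positive) parts; the empty partition is the empty set.
\<close>

definition distinct_partition :: "nat set \<Rightarrow> bool" where
  "distinct_partition \<pi> \<longleftrightarrow> finite \<pi> \<and> 0 \<notin> \<pi>"

abbreviation sigma :: "nat set \<Rightarrow> nat" where
  "sigma \<pi> \<equiv> \<Sum>\<pi>"

definition Q2 :: "nat \<Rightarrow> nat" where
  "Q2 n = card {\<pi>. distinct_partition \<pi> \<and> (\<forall>a\<in>\<pi>. \<not> [a = 2] (mod 4)) \<and> sigma \<pi> = n}"

definition consecutive :: "nat set \<Rightarrow> nat \<Rightarrow> nat \<Rightarrow> bool" where
  "consecutive A a b \<longleftrightarrow> a \<in> A \<and> b \<in> A \<and> a < b \<and> \<not> (\<exists>c\<in>A. a < c \<and> c < b)"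

definition gollnitz_gordon :: "nat set \<Rightarrow> bool" where
  "gollnitz_gordon \<pi> \<longleftrightarrow> distinct_partition \<pi> \<and>
     (\<forall>a b. consecutive \<pi> a b \<longrightarrow> a + 2 \<le> b \<and> (even a \<or> even b \<longrightarrow> a + 2 < b))"

definition t :: "nat \<Rightarrow> nat set \<Rightarrow> nat" where
  "t b \<pi> = card {a \<in> \<pi>. odd a \<and> a < b}"

definition S :: "nat set set" where
  "S = {\<pi>. gollnitz_gordon \<pi> \<and> (\<forall>b\<in>\<pi>. even b \<longrightarrow> [b = 2 * t b \<pi>] (mod 4))}"

definition two_string :: "nat set \<Rightarrow> nat set \<Rightarrow> bool" where
  "two_string \<pi> \<chi> \<longleftrightarrow> \<chi> \<noteq> {} \<and> \<chi> \<subseteq> \<pi> \<and> (\<forall>a b. consecutive \<chi> a b \<longrightarrow> b = a + 2)"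

definition chains :: "nat set \<Rightarrow> nat set set" where
  "chains \<pi> = {\<chi>. two_string \<pi> \<chi> \<and> (\<forall>\<chi>'. two_string \<pi> \<chi>' \<and> \<chi> \<subseteq> \<chi>' \<longrightarrow> \<chi>' = \<chi>)}"

definition odd_chain :: "nat set \<Rightarrow> bool" where
  "odd_chain \<chi> \<longleftrightarrow> (\<forall>a\<in>\<chi>. odd a)"

abbreviation least_part :: "nat set \<Rightarrow> nat" where
  "least_part \<chi> \<equiv> Min \<chi>"

definition chain_weight :: "nat set \<Rightarrow> nat set \<Rightarrow> nat" where
  "chain_weight \<pi> \<chi> =
     (if odd_chain \<chi> \<and> least_part \<chi> \<ge> 5 \<and>
         [least_part \<chi> = 1 + 2 * t (least_part \<chi>) \<pi>] (mod 4)
      then 2 else 1)"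

definition weight :: "nat set \<Rightarrow> nat" where
  "weight \<pi> = (\<Prod>\<chi>\<in>chains \<pi>. chain_weight \<pi> \<chi>)"

end

theory Submission
  imports Defs "HOL-Computational_Algebra.Polynomial"
begin

text \<open>
  A partition in \<open>S\<close> is a set \<open>O\<close> of odd numbers together with some even \<open>b\<close> having no
  neighbour in \<open>O\<close> and \<open>b - 2 t(b)\<close> divisible by 4. As \<open>b\<close> runs through the even numbers, the level
  \<open>x = b - 2 t(b)\<close> rises by 2 or stays put, according to whether \<open>b + 1\<close> is missing from or lies
  in \<open>O\<close>. Hence each positive level divisible by 4 contributes a factor: \<open>1 + q\<^sup>b\<close> if it is attained
  only once, at \<open>b\<close>, and the chain weight 2 if an odd chain starts right after it is first
  attained. Scanning the odd numbers from below therefore gives linear recurrences for the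
  generating functions with \<open>n\<close> odd numbers scanned and \<open>k\<close> of them chosen. They are solved by
  products of an elementary symmetric polynomial of \<open>q, q\<^sup>3, q\<^sup>5, \<dots>\<close> with the factors
  \<open>1 + q ^ (4 * j)\<close> of the levels already passed, and such products count distinct odd parts
  together with distinct multiples of 4.
\<close>

section \<open>Local reformulation of membership in \<open>S\<close> and of the weight\<close>

definition odds :: "nat set \<Rightarrow> nat set" where
  "odds \<pi> = {a \<in> \<pi>. odd a}"

text \<open>Membership in \<open>S\<close> by conditions at single even parts. Distinct odd parts
  differ by 2 anyway, and a gap of exactly 2 between even parts is ruled out by the
  congruence.\<close>

definition good :: "nat set \<Rightarrow> bool" where
  "good \<pi> \<longleftrightarrow> finite \<pi> \<and> 0 \<notin> \<pi> \<and>
     (\<forall>b\<in>\<pi>. even b \<longrightarrow> b - 1 \<notin> \<pi> \<and> b + 1 \<notin> \<pi> \<and> [b = 2 * t b \<pi>] (mod 4))"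

text \<open>These are the least parts of the chains of weight 2.\<close>

definition starts :: "nat set \<Rightarrow> nat set" where
  "starts \<pi> = {a \<in> \<pi>. odd a \<and> a \<ge> 5 \<and> a - 2 \<notin> \<pi> \<and> [a = 1 + 2 * t a \<pi>] (mod 4)}"

section \<open>Chains\<close>

text \<open>Walk upwards from \<open>a\<close> in steps of 2 until \<pi> is left; the chains will be
  the runs that cannot be prolonged downwards.\<close>

definition run :: "nat set \<Rightarrow> nat \<Rightarrow> nat set" where
  "run \<pi> a = {a + 2 * i | i. \<forall>j\<le>i. a + 2 * j \<in> \<pi>}"

lemma run_subset: "run \<pi> a \<subseteq> \<pi>"
  by (auto simp: run_def)

lemma mem_run: "a \<in> \<pi> \<Longrightarrow> a \<in> run \<pi> a"
  by (auto simp: run_def intro!: exI[of _ 0])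

lemma Min_run: "finite \<pi> \<Longrightarrow> a \<in> \<pi> \<Longrightarrow> Min (run \<pi> a) = a"
  using finite_subset[OF run_subset, of \<pi> a] mem_run[of a \<pi>]
  by (intro Min_eqI) (auto simp: run_def)

lemma two_string_run:
  assumes "a \<in> \<pi>" shows "two_string \<pi> (run \<pi> a)"
proof -
  have "y = x + 2" if c: "consecutive (run \<pi> a) x y" for x y
  proof -
    from c obtain i j where x: "x = a + 2 * i" and y: "y = a + 2 * j" "\<forall>k\<le>j. a + 2 * k \<in> \<pi>"
      and "x < y" by (auto simp: consecutive_def run_def)
    then have "i < j" by simp
    have "a + 2 * Suc i \<in> run \<pi> a"
      unfolding run_def using \<open>i < j\<close> y(2) by (intro CollectI exI[of _ "Suc i"]) auto
    then have "\<not> a + 2 * Suc i < y"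
      using c x unfolding consecutive_def by auto
    then show ?thesis using x y(1) \<open>i < j\<close> by simp
  qed
  then show ?thesis using assms run_subset mem_run unfolding two_string_def by blast
qed

lemma two_string_subset_run:
  assumes "finite \<pi>" "two_string \<pi> \<chi>"
  shows "\<chi> \<subseteq> run \<pi> (Min \<chi>)"
proof
  have fin: "finite \<chi>" and ne: "\<chi> \<noteq> {}" and sub: "\<chi> \<subseteq> \<pi>"
    using assms finite_subset by (auto simp: two_string_def)
  fix x assume "x \<in> \<chi>"
  then show "x \<in> run \<pi> (Min \<chi>)"
  proof (induction x rule: less_induct)
    case (less x)
    show ?case
    proof (cases "x = Min \<chi>")
      case True
      then show ?thesis using mem_run less.prems sub by auto
    next
      case False
      have lt: "Min \<chi> < x" using False fin less.prems by (metis Min_le le_neq_implies_less)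
      \<comment> \<open>\<open>y\<close> is the predecessor of \<open>x\<close> in \<chi>, so a
        two-string forces \<open>x = y + 2\<close> and the run reaching \<open>y\<close> extends to
        \<open>x\<close>.\<close>
      define y where "y = Max {c \<in> \<chi>. c < x}"
      have S: "finite {c \<in> \<chi>. c < x}" "{c \<in> \<chi>. c < x} \<noteq> {}"
        using fin ne lt Min_in by auto
      have y: "y \<in> \<chi>" "y < x" using Max_in[OF S] unfolding y_def by auto
      have "consecutive \<chi> y x" unfolding consecutive_def
        using y less.prems Max_ge[OF S(1)] unfolding y_def[symmetric]
        by (metis (mono_tags, lifting) leD mem_Collect_eq)
      then have x: "x = y + 2" using assms(2) by (auto simp: two_string_def)
      from less.IH[OF y(2,1)] obtain i where i: "y = Min \<chi> + 2 * i" "\<forall>j\<le>i. Min \<chi> + 2 * j \<in> \<pi>"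
        by (auto simp: run_def)
      show ?thesis unfolding run_def
        using i x less.prems sub by (intro CollectI exI[of _ "Suc i"]) (auto simp: le_Suc_eq)
    qed
  qed
qed

text \<open>A two-string lies in the run from its minimum, so a maximal one equals that run, and it
  can grow only by prepending \<open>a - 2\<close>. For \<open>a \<le> 2\<close> the truncated
  difference is 0, which is not a part, so the test \<open>a - 2 \<notin> \<pi>\<close> stays
  correct.\<close>

lemma chains_eq:
  assumes "finite \<pi>" "0 \<notin> \<pi>"
  shows "chains \<pi> = run \<pi> ` {a \<in> \<pi>. a - 2 \<notin> \<pi>}"
proof (intro equalityI subsetI)
  fix \<chi> assume "\<chi> \<in> chains \<pi>"
  then have ts: "two_string \<pi> \<chi>" and mx: "\<And>\<chi>'. two_string \<pi> \<chi>' \<Longrightarrow> \<chi> \<subseteq> \<chi>' \<Longrightarrow> \<chi>' = \<chi>"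
    by (auto simp: chains_def)
  have fin: "finite \<chi>" and ne: "\<chi> \<noteq> {}" and sub: "\<chi> \<subseteq> \<pi>"
    using ts assms(1) finite_subset by (auto simp: two_string_def)
  define a where "a = Min \<chi>"
  have a: "a \<in> \<pi>" "a \<in> \<chi>" using Min_in[OF fin ne] sub a_def by auto
  have run: "run \<pi> a = \<chi>"
    using mx[OF two_string_run[OF a(1)]] two_string_subset_run[OF assms(1) ts] a_def by simp
  have "a - 2 \<notin> \<pi>"
  proof
    assume a2: "a - 2 \<in> \<pi>"
    then have "a > 2" using assms(2) by (cases "a > 2") auto
    have "run \<pi> a \<subseteq> run \<pi> (a - 2)"
    proof
      fix x assume "x \<in> run \<pi> a"
      then obtain i where i: "x = a + 2 * i" "\<forall>j\<le>i. a + 2 * j \<in> \<pi>" by (auto simp: run_def)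
      have "a - 2 + 2 * j \<in> \<pi>" if "j \<le> Suc i" for j
      proof (cases j)
        case (Suc k)
        then have "a - 2 + 2 * j = a + 2 * k" using \<open>a > 2\<close> by simp
        then show ?thesis using that i(2) Suc by (metis Suc_le_mono)
      qed (use a2 in simp)
      then show "x \<in> run \<pi> (a - 2)" unfolding run_def
        using i(1) \<open>a > 2\<close> by (intro CollectI exI[of _ "Suc i"]) auto
    qed
    then have "run \<pi> (a - 2) = \<chi>" using mx two_string_run[OF a2] run by auto
    then have "a - 2 \<in> \<chi>" using mem_run[OF a2] by simp
    then have "a \<le> a - 2" using fin a_def by simp
    then show False using \<open>a > 2\<close> by simp
  qed
  then show "\<chi> \<in> run \<pi> ` {a \<in> \<pi>. a - 2 \<notin> \<pi>}" using a run by auto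
next
  fix \<chi> assume "\<chi> \<in> run \<pi> ` {a \<in> \<pi>. a - 2 \<notin> \<pi>}"
  then obtain a where a: "a \<in> \<pi>" "a - 2 \<notin> \<pi>" "\<chi> = run \<pi> a" by auto
  have "\<chi>' = \<chi>" if ts: "two_string \<pi> \<chi>'" and sub: "\<chi> \<subseteq> \<chi>'" for \<chi>'
  proof -
    have s: "\<chi>' \<subseteq> run \<pi> (Min \<chi>')" by (rule two_string_subset_run[OF assms(1) ts])
    have "a \<in> run \<pi> (Min \<chi>')" using s sub mem_run[OF a(1)] a(3) by auto
    then obtain i where i: "a = Min \<chi>' + 2 * i" "\<forall>j\<le>i. Min \<chi>' + 2 * j \<in> \<pi>"
      by (auto simp: run_def)
    have "i = 0"
    proof (cases i)
      case (Suc k)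
      then have "a - 2 = Min \<chi>' + 2 * k" using i(1) by simp
      then show ?thesis using i(2) a(2) Suc by auto
    qed
    then show ?thesis using i(1) s sub a(3) by auto
  qed
  then show "\<chi> \<in> chains \<pi>" using two_string_run[OF a(1)] a(3) by (auto simp: chains_def)
qed

lemma odd_chain_run: "a \<in> \<pi> \<Longrightarrow> odd_chain (run \<pi> a) \<longleftrightarrow> odd a"
  using mem_run[of a \<pi>] by (auto simp: odd_chain_def run_def)

text \<open>Chains correspond to their least parts, with \<open>Min\<close> as inverse of
  \<open>run\<close>, so the product over chains becomes a product over starting points.\<close>

lemma weight_eq:
  assumes "finite \<pi>" "0 \<notin> \<pi>"
  shows "weight \<pi> = 2 ^ card (starts \<pi>)"
proof -
  let ?A = "{a \<in> \<pi>. a - 2 \<notin> \<pi>}"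
  have inj: "inj_on (run \<pi>) ?A"
    by (rule inj_on_inverseI[of _ Min]) (use Min_run[OF assms(1)] in auto)
  have "weight \<pi> = (\<Prod>a\<in>?A. chain_weight \<pi> (run \<pi> a))"
    unfolding weight_def chains_eq[OF assms] using inj by (simp add: prod.reindex)
  also have "\<dots> = (\<Prod>a\<in>?A. if a \<in> starts \<pi> then 2 else 1)"
    by (intro prod.cong refl)
      (auto simp: chain_weight_def Min_run[OF assms(1)] odd_chain_run starts_def)
  also have "\<dots> = (\<Prod>a\<in>starts \<pi>. 2)"
    using assms(1) by (intro prod.mono_neutral_cong_right) (auto simp: starts_def)
  finally show ?thesis by simp
qed

section \<open>The set S\<close>

lemma t_cong: "(\<And>a. odd a \<Longrightarrow> a < b \<Longrightarrow> a \<in> \<pi> \<longleftrightarrow> a \<in> \<rho>) \<Longrightarrow> t b \<pi> = t b \<rho>"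
  unfolding t_def by (rule arg_cong[where f = card]) auto

lemma S_eq: "S = Collect good"
proof (intro equalityI subsetI CollectI)
  fix \<pi> assume "\<pi> \<in> S"
  then have gg: "\<And>a b. consecutive \<pi> a b \<Longrightarrow> a + 2 \<le> b \<and> (even a \<or> even b \<longrightarrow> a + 2 < b)"
    and fin: "finite \<pi>" "0 \<notin> \<pi>" and tt: "\<And>b. b \<in> \<pi> \<Longrightarrow> even b \<Longrightarrow> [b = 2 * t b \<pi>] (mod 4)"
    by (auto simp: S_def gollnitz_gordon_def distinct_partition_def)
  have no_succ: "Suc a \<notin> \<pi>" if "a \<in> \<pi>" for a
    using gg[of a "Suc a"] that by (auto simp: consecutive_def)
  have "b - 1 \<notin> \<pi>" if "b \<in> \<pi>" for b
    using no_succ[of "b - 1"] that fin by (cases b) auto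
  then show "good \<pi>" using no_succ fin tt by (auto simp: good_def)
next
  fix \<pi> assume "\<pi> \<in> Collect good"
  then have fin: "finite \<pi>" "0 \<notin> \<pi>" and tt: "\<And>b. b \<in> \<pi> \<Longrightarrow> even b \<Longrightarrow> [b = 2 * t b \<pi>] (mod 4)"
    and gl: "\<And>b. b \<in> \<pi> \<Longrightarrow> even b \<Longrightarrow> b - 1 \<notin> \<pi>"
    and gr: "\<And>b. b \<in> \<pi> \<Longrightarrow> even b \<Longrightarrow> b + 1 \<notin> \<pi>"
    by (auto simp: good_def)
  have "a + 2 \<le> b \<and> (even a \<or> even b \<longrightarrow> a + 2 < b)" if "consecutive \<pi> a b" for a b
  proof -
    have ab: "a \<in> \<pi>" "b \<in> \<pi>" "a < b" using that by (auto simp: consecutive_def)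
    have 1: "b \<noteq> a + 1" using gr[of a] gl[of b] ab by (cases "even a") auto
    moreover have False if "b = a + 2" "even a \<or> even b"
    proof -
      have ev: "even a" "even b" using that by auto
      \<comment> \<open>The only odd number between \<open>a\<close> and \<open>a + 2\<close> is
        \<open>a + 1\<close>, which is not a part; so both congruences have the same right-hand
        side, although \<open>a\<close> and \<open>a + 2\<close> differ modulo 4.\<close>
      have "t b \<pi> = t a \<pi>" unfolding t_def
        using gr[OF ab(1) ev(1)] that(1) ev(1)
        by (intro arg_cong[where f = card]) (auto simp: less_Suc_eq)
      then have "[a + 2 = a] (mod 4)"
        using tt[OF ab(1) ev(1)] tt[OF ab(2) ev(2)] that(1) by (metis cong_sym cong_trans)
      then have "[2 = 0::nat] (mod 4)" by (metis add_0_right cong_add_lcancel_nat)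
      then show False by (simp add: cong_def)
    qed
    ultimately show ?thesis using ab(3)
      by (metis Suc_eq_plus1 Suc_leI add_2_eq_Suc' le_neq_implies_less)
  qed
  then show "\<pi> \<in> S" using fin tt by (auto simp: S_def gollnitz_gordon_def distinct_partition_def)
qed

section \<open>Recurrences for the weighted generating functions\<close>

text \<open>For \<open>n = 0\<close> the truncated \<open>2 * n - 1\<close> is 0, which is never a part.\<close>

definition G0 :: "nat \<Rightarrow> nat \<Rightarrow> nat set set" where
  "G0 n k = {\<pi>. good \<pi> \<and> \<pi> \<subseteq> {..<2 * n} \<and> card (odds \<pi>) = k \<and> 2 * n - 1 \<notin> \<pi>}"

definition G1 :: "nat \<Rightarrow> nat \<Rightarrow> nat set set" where
  "G1 n k = {\<pi>. good \<pi> \<and> \<pi> \<subseteq> {..<2 * n} \<and> card (odds \<pi>) = k \<and> 2 * n - 1 \<in> \<pi>}"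

text \<open>For finite \<pi> without 0 this is \<open>weight \<pi>\<close> times
  \<open>q ^ \<Sum>\<pi>\<close>, over any commutative ring; \<open>q\<close> becomes a polynomial
  indeterminate only when coefficients are compared.\<close>

definition term_of :: "'a::comm_ring_1 \<Rightarrow> nat set \<Rightarrow> 'a" where
  "term_of q \<pi> = 2 ^ card (starts \<pi>) * q ^ \<Sum>\<pi>"

definition C0 :: "'a::comm_ring_1 \<Rightarrow> nat \<Rightarrow> nat \<Rightarrow> 'a" where
  "C0 q n k = (\<Sum>\<pi>\<in>G0 n k. term_of q \<pi>)"

definition C1 :: "'a::comm_ring_1 \<Rightarrow> nat \<Rightarrow> nat \<Rightarrow> 'a" where
  "C1 q n k = (\<Sum>\<pi>\<in>G1 n k. term_of q \<pi>)"

text \<open>Indicates that \<open>2 * n\<close> is positive and congruent to \<open>2 * k\<close>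
  modulo 4. With \<open>k\<close> odd parts below, this is both when \<open>2 * n\<close> satisfies
  the congruence for an even part and when an odd chain starting at \<open>2 * n + 1\<close> has
  weight 2.\<close>

definition \<delta> :: "nat \<Rightarrow> nat \<Rightarrow> 'a::comm_ring_1" where
  "\<delta> n k = (if n > 0 \<and> even (n + k) then 1 else 0)"

lemma finite_G [simp]: "finite (G0 n k)" "finite (G1 n k)"
  by (rule finite_subset[of _ "Pow {..<2 * n}"]; auto simp: G0_def G1_def)+

lemma G_disjoint: "G0 n k \<inter> G1 n k = {}"
  by (auto simp: G0_def G1_def)

lemma mem_G_Un:
  "\<pi> \<in> G0 n k \<union> G1 n k \<longleftrightarrow> good \<pi> \<and> \<pi> \<subseteq> {..<2 * n} \<and> card (odds \<pi>) = k"
  by (auto simp: G0_def G1_def)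

lemma t_full: "\<pi> \<subseteq> {..<2 * n} \<Longrightarrow> 2 * n \<le> b \<Longrightarrow> t b \<pi> = card (odds \<pi>)"
  unfolding t_def odds_def by (rule arg_cong[where f = card]) auto

lemma t_insert: "b \<le> c \<Longrightarrow> t b (insert c \<pi>) = t b \<pi>"
  by (rule t_cong) auto

lemma cong_4_double: "[2 * n = 2 * k] (mod 4) \<longleftrightarrow> even (n + k)" for n k :: nat
  by (simp add: cong_def) presburger

section \<open>Effect of adding a new largest part\<close>

lemma good_subset:
  assumes "good (insert c \<pi>)" "\<pi> \<subseteq> {..<c}"
  shows "good \<pi>"
  using assms t_insert[of _ c \<pi>] unfolding good_def
  by (metis (no_types, lifting) finite_insert insertCI lessThan_iff less_imp_le_nat subsetD)

lemma good_insert_odd: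
  assumes "\<pi> \<subseteq> {..<2 * n}"
  shows "good (insert (2 * n + 1) \<pi>) \<longleftrightarrow> good \<pi>"
proof
  show "good (insert (2 * n + 1) \<pi>) \<Longrightarrow> good \<pi>"
    by (erule good_subset) (use assms in auto)
  assume g: "good \<pi>"
  have lt: "b < 2 * n" if "b \<in> \<pi>" for b using assms that by auto
  have "b - 1 \<noteq> 2 * n + 1 \<and> b + 1 \<noteq> 2 * n + 1 \<and> t b (insert (2 * n + 1) \<pi>) = t b \<pi>"
    if "b \<in> \<pi>" for b
    using lt[OF that] t_insert[of b "2 * n + 1" \<pi>] by auto
  then show "good (insert (2 * n + 1) \<pi>)"
    using g unfolding good_def by (simp add: ball_conj_distrib)
qed

text \<open>All odd parts of \<pi> lie below \<open>2 * n\<close>, so \<open>t\<close> at the new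
  part is \<open>card (odds \<pi>)\<close>, while \<open>t\<close> at the old parts is
  unchanged.\<close>

lemma good_insert_even:
  assumes "\<pi> \<subseteq> {..<2 * n}"
  shows "good (insert (2 * n) \<pi>) \<longleftrightarrow>
    good \<pi> \<and> n > 0 \<and> 2 * n - 1 \<notin> \<pi> \<and> even (n + card (odds \<pi>))"
proof
  assume g: "good (insert (2 * n) \<pi>)"
  then have "good \<pi>" by (rule good_subset) (use assms in auto)
  with g show "good \<pi> \<and> n > 0 \<and> 2 * n - 1 \<notin> \<pi> \<and> even (n + card (odds \<pi>))"
    using t_insert[of "2 * n" "2 * n" \<pi>] t_full[OF assms, of "2 * n"]
    by (auto simp: good_def cong_4_double)
next
  assume g: "good \<pi> \<and> n > 0 \<and> 2 * n - 1 \<notin> \<pi> \<and> even (n + card (odds \<pi>))"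
  have lt: "b < 2 * n" if "b \<in> \<pi>" for b using assms that by auto
  have lt': "b - 1 \<noteq> 2 * n" if "b \<in> \<pi>" for b
    using lt[OF that] by auto
  have lt'': "b + 1 \<noteq> 2 * n" if "b \<in> \<pi>" "even b" for b
    using that by presburger
  have "2 * n + 1 \<notin> \<pi>" "2 * n - 1 \<noteq> 2 * n" using lt[of "2 * n + 1"] g by auto
  then show "good (insert (2 * n) \<pi>)"
    using g lt lt' lt'' t_full[OF assms, of "2 * n"] unfolding good_def
    by (auto simp: t_insert less_imp_le cong_4_double)
qed

lemma starts_insert_even:
  assumes "\<pi> \<subseteq> {..<2 * n}"
  shows "starts (insert (2 * n) \<pi>) = starts \<pi>"
proof -
  have lt: "b < 2 * n" if "b \<in> \<pi>" for b using assms that by auto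
  then have "b - 2 \<noteq> 2 * n" if "b \<in> \<pi>" for b using that by fastforce
  then show ?thesis using lt unfolding starts_def by (auto simp: t_insert less_imp_le)
qed

lemma starts_insert_odd:
  assumes "\<pi> \<subseteq> {..<2 * n}" "good \<pi>"
  shows "starts (insert (2 * n + 1) \<pi>) =
    (if n > 0 \<and> 2 * n - 1 \<notin> \<pi> \<and> even (n + card (odds \<pi>))
     then insert (2 * n + 1) (starts \<pi>) else starts \<pi>)"
proof -
  have lt: "b < 2 * n" if "b \<in> \<pi>" for b using assms that by auto
  then have ne: "b - 2 \<noteq> 2 * n + 1" if "b \<in> \<pi>" for b using that by fastforce
  have old: "b \<in> starts (insert (2 * n + 1) \<pi>) \<longleftrightarrow> b \<in> starts \<pi>" if "b < 2 * n" for b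
    using that ne t_insert[of b "2 * n + 1" \<pi>] unfolding starts_def by auto
  \<comment> \<open>This turns \<open>n > 0\<close> into the bound 5 in \<open>starts\<close>: for
    \<open>n = 1\<close> without the part 1, \<pi> is empty and has 0 odd parts, so
    \<open>1 + 0\<close> violates the parity condition.\<close>
  have "n \<noteq> 1" if "2 * n - 1 \<notin> \<pi>" "even (n + card (odds \<pi>))"
  proof
    assume "n = 1"
    then have "x \<notin> \<pi>" for x
      using that(1) lt[of x] assms(2) by (cases "x = 0"; cases "x = 1") (auto simp: good_def)
    then have "\<pi> = {}" by auto
    then show False using that(2) \<open>n = 1\<close> by (simp add: odds_def)
  qed
  moreover have "2 * n + 1 - 2 \<notin> insert (2 * n + 1) \<pi> \<longleftrightarrow> 2 * n - 1 \<notin> \<pi>" by auto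
  moreover have "[2 * n + 1 = 1 + 2 * card (odds \<pi>)] (mod 4) \<longleftrightarrow> even (n + card (odds \<pi>))"
    by (metis add.commute cong_4_double cong_add_lcancel_nat)
  ultimately have new: "2 * n + 1 \<in> starts (insert (2 * n + 1) \<pi>) \<longleftrightarrow>
      n > 0 \<and> 2 * n - 1 \<notin> \<pi> \<and> even (n + card (odds \<pi>))"
    using t_insert[of "2 * n + 1" "2 * n + 1" \<pi>] t_full[OF assms(1), of "2 * n + 1"]
    unfolding starts_def by auto
  have sub: "starts (insert (2 * n + 1) \<pi>) \<subseteq> insert (2 * n + 1) \<pi>" "starts \<pi> \<subseteq> \<pi>"
    by (auto simp: starts_def)
  have old': "b \<in> starts (insert (2 * n + 1) \<pi>) \<longleftrightarrow> b \<in> starts \<pi>" if "b \<noteq> 2 * n + 1" for b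
    using old[of b] sub lt[of b] that by blast
  have "2 * n + 1 \<notin> starts \<pi>" using sub lt[of "2 * n + 1"] by auto
  then show ?thesis
    using old' new by (intro set_eqI) (metis insert_iff)
qed

lemma odds_insert: "odds (insert c \<pi>) = (if odd c then insert c (odds \<pi>) else odds \<pi>)"
  by (auto simp: odds_def)

lemma finite_odds [simp]: "finite \<pi> \<Longrightarrow> finite (odds \<pi>)"
  by (simp add: odds_def)

lemma subset_less_double:
  "\<pi> \<subseteq> {..<2 * Suc n} \<longleftrightarrow> \<pi> - {2 * n, 2 * n + 1} \<subseteq> {..<2 * n}"
  by (auto simp: less_Suc_eq subset_iff)

lemma inj_on_insert: "inj_on (insert c) {\<pi>. c \<notin> \<pi>}"
  by (rule inj_on_inverseI[of _ "\<lambda>\<pi>. \<pi> - {c}"]) auto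

section \<open>Recursive description of the families by their largest parts\<close>

lemma G0_Suc:
  "G0 (Suc n) k = (G0 n k \<union> G1 n k) \<union>
     (if n > 0 \<and> even (n + k) then insert (2 * n) ` G0 n k else {})" (is "?L = ?A \<union> ?B")
proof (intro equalityI subsetI)
  fix \<pi> assume p: "\<pi> \<in> ?L"
  then have g: "good \<pi>" "\<pi> - {2 * n, 2 * n + 1} \<subseteq> {..<2 * n}" "card (odds \<pi>) = k"
    "2 * n + 1 \<notin> \<pi>" unfolding G0_def subset_less_double by auto
  show "\<pi> \<in> ?A \<union> ?B"
  proof (cases "2 * n \<in> \<pi>")
    case False
    then have "\<pi> \<subseteq> {..<2 * n}" using g by auto
    then have "\<pi> \<in> ?A" using g unfolding mem_G_Un by blast
    then show ?thesis by blast
  next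
    case True
    \<comment> \<open>The part \<open>2 * n\<close> forbids its neighbour \<open>2 * n - 1\<close>,
      so the remainder lies in \<open>G0\<close>, never in \<open>G1\<close>.\<close>
    define \<rho> where "\<rho> = \<pi> - {2 * n}"
    have r: "\<pi> = insert (2 * n) \<rho>" "\<rho> \<subseteq> {..<2 * n}" using True g(2,4) by (auto simp: \<rho>_def)
    have k: "card (odds \<rho>) = k" using g(3) by (simp add: r(1) odds_insert)
    from good_insert_even[OF r(2)] g(1) k r
    have "n > 0 \<and> even (n + k)" "\<rho> \<in> G0 n k" by (auto simp: G0_def)
    then show ?thesis using r(1) by auto
  qed
next
  fix \<pi> assume "\<pi> \<in> ?A \<union> ?B"
  then consider "\<pi> \<in> ?A" | \<rho> where "n > 0" "even (n + k)" "\<rho> \<in> G0 n k" "\<pi> = insert (2 * n) \<rho>"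
    by (auto split: if_splits)
  then show "\<pi> \<in> ?L"
  proof cases
    case 1
    then show ?thesis unfolding mem_G_Un by (auto simp: G0_def)
  next
    case 2
    then have r: "good \<rho>" "\<rho> \<subseteq> {..<2 * n}" "card (odds \<rho>) = k" "2 * n - 1 \<notin> \<rho>"
      by (auto simp: G0_def)
    have "good \<pi>" using good_insert_even[OF r(2)] 2 r by simp
    then show ?thesis using r 2(4) by (auto simp: G0_def odds_insert)
  qed
qed

lemma G1_Suc: "G1 (Suc n) (Suc k) = insert (2 * n + 1) ` (G0 n k \<union> G1 n k)" (is "?L = ?R")
proof (intro equalityI subsetI)
  fix \<pi> assume "\<pi> \<in> ?L"
  then have g: "good \<pi>" "\<pi> - {2 * n, 2 * n + 1} \<subseteq> {..<2 * n}" "card (odds \<pi>) = Suc k"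
    "2 * n + 1 \<in> \<pi>" unfolding G1_def subset_less_double by auto
  then have "2 * n \<notin> \<pi>" by (auto simp: good_def)
  define \<rho> where "\<rho> = \<pi> - {2 * n + 1}"
  have r: "\<pi> = insert (2 * n + 1) \<rho>" "\<rho> \<subseteq> {..<2 * n}" "2 * n + 1 \<notin> \<rho>"
    using \<open>2 * n \<notin> \<pi>\<close> g(2,4) by (auto simp: \<rho>_def)
  have gr: "good \<rho>" using g(1) r good_insert_odd by simp
  then have "card (odds \<rho>) = k"
    using g(3) r by (simp add: odds_insert good_def) (simp add: odds_def)
  then show "\<pi> \<in> ?R" using r gr mem_G_Un by blast
next
  fix \<pi> assume "\<pi> \<in> ?R"
  then obtain \<rho> where r: "\<pi> = insert (2 * n + 1) \<rho>" "good \<rho>" "\<rho> \<subseteq> {..<2 * n}" "card (odds \<rho>) = k"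
    unfolding image_iff Bex_def mem_G_Un by blast
  then have "good \<pi>" using good_insert_odd by simp
  moreover have "2 * n + 1 \<notin> odds \<rho>" "finite \<rho>" using r by (auto simp: odds_def good_def)
  ultimately show "\<pi> \<in> ?L" using r by (auto simp: G1_def odds_insert)
qed

lemma G1_zero: "G1 n 0 = {}"
proof -
  have False if "\<pi> \<in> G1 n 0" for \<pi>
  proof -
    have "finite \<pi>" "0 \<notin> \<pi>" "card (odds \<pi>) = 0" "2 * n - 1 \<in> \<pi>"
      using that by (auto simp: G1_def good_def)
    moreover from this have "odd (2 * n - 1)" by (cases n) auto
    ultimately show False by (auto simp: odds_def)
  qed
  then show ?thesis by auto
qed

lemma G_0: "G0 0 k = (if k = 0 then {{}} else {})" "G1 0 k = {}"
  by (auto simp: G0_def G1_def good_def odds_def)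

section \<open>Recurrences for the generating functions\<close>

lemma C0_Suc: "C0 q (Suc n) k = C1 q n k + C0 q n k * (1 + \<delta> n k * q ^ (2 * n))"
proof -
  have lt: "\<pi> \<subseteq> {..<2 * n}" if "\<pi> \<in> G0 n k \<union> G1 n k" for \<pi>
    using that unfolding mem_G_Un by blast
  have ni: "2 * n \<notin> \<pi>" if "\<pi> \<in> G0 n k \<union> G1 n k" for \<pi>
    using lt[OF that] by auto
  \<comment> \<open>An added even part leaves \<open>starts\<close> unchanged, hence it contributes
    only \<open>q ^ (2 * n)\<close>.\<close>
  have *: "(\<Sum>\<pi>\<in>insert (2 * n) ` G0 n k. term_of q \<pi>) = C0 q n k * q ^ (2 * n)"
  proof -
    have "inj_on (insert (2 * n)) (G0 n k)"
      using inj_on_insert by (rule inj_on_subset) (use ni in blast)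
    moreover have "term_of q (insert (2 * n) \<pi>) = term_of q \<pi> * q ^ (2 * n)" if "\<pi> \<in> G0 n k" for \<pi>
    proof -
      have "finite \<pi>" "2 * n \<notin> \<pi>" "\<pi> \<subseteq> {..<2 * n}"
        using that ni[of \<pi>] lt[of \<pi>] by (auto simp: G0_def good_def)
      then show ?thesis by (simp add: term_of_def starts_insert_even power_add)
    qed
    ultimately show ?thesis by (simp add: sum.reindex C0_def sum_distrib_right)
  qed
  have A: "(\<Sum>\<pi>\<in>G0 n k \<union> G1 n k. term_of q \<pi>) = C0 q n k + C1 q n k"
    by (simp add: C0_def C1_def sum.union_disjoint G_disjoint)
  show ?thesis
  proof (cases "n > 0 \<and> even (n + k)")
    case True
    have "(G0 n k \<union> G1 n k) \<inter> insert (2 * n) ` G0 n k = {}" using ni by blast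
    then have "C0 q (Suc n) k = C0 q n k + C1 q n k + C0 q n k * q ^ (2 * n)"
      using True unfolding C0_def[of q "Suc n"] G0_Suc by (simp add: sum.union_disjoint A * del: Un_iff)
    then show ?thesis using True by (simp add: \<delta>_def algebra_simps)
  next
    case False
    then show ?thesis unfolding C0_def[of q "Suc n"] G0_Suc if_not_P[OF False] Un_empty_right A
      by (auto simp: \<delta>_def)
  qed
qed

text \<open>If \<open>2 * n - 1\<close> is a part, \<open>2 * n + 1\<close> prolongs its chain and
  the weight stays; otherwise it starts a new chain, of weight
  \<open>1 + \<delta> n k\<close>.\<close>

lemma C1_Suc_Suc:
  "C1 q (Suc n) (Suc k) = q ^ (2 * n + 1) * (C1 q n k + C0 q n k * (1 + \<delta> n k))"
proof -
  have lt: "\<pi> \<subseteq> {..<2 * n}" "good \<pi>" "card (odds \<pi>) = k" if "\<pi> \<in> G0 n k \<union> G1 n k" for \<pi>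
    using that unfolding mem_G_Un by blast+
  have ni: "2 * n + 1 \<notin> \<pi>" if "\<pi> \<in> G0 n k \<union> G1 n k" for \<pi>
    using lt(1)[OF that] by auto
  have inj: "inj_on (insert (2 * n + 1)) (G0 n k \<union> G1 n k)"
    using inj_on_insert by (rule inj_on_subset) (use ni in blast)
  have tm: "term_of q (insert (2 * n + 1) \<pi>) =
      q ^ (2 * n + 1) * term_of q \<pi> * (if 2 * n - 1 \<notin> \<pi> then 1 + \<delta> n k else 1)"
    if p: "\<pi> \<in> G0 n k \<union> G1 n k" for \<pi>
  proof -
    note st = starts_insert_odd[OF lt(1,2)[OF p], unfolded lt(3)[OF p]]
    have f: "finite \<pi>" using lt(2)[OF p] by (simp add: good_def)
    have "finite (starts \<pi>)" "2 * n + 1 \<notin> starts \<pi>"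
      using f ni[OF p] by (auto simp: starts_def)
    then have "(2::'a) ^ card (starts (insert (2 * n + 1) \<pi>)) =
        2 ^ card (starts \<pi>) * (if 2 * n - 1 \<notin> \<pi> then 1 + \<delta> n k else 1)"
      unfolding st by (simp add: \<delta>_def)
    moreover have "\<Sum>(insert (2 * n + 1) \<pi>) = 2 * n + 1 + \<Sum>\<pi>" using f ni[OF p] by simp
    ultimately show ?thesis by (simp only: term_of_def power_add mult_ac)
  qed
  have "C1 q (Suc n) (Suc k) =
      (\<Sum>\<pi>\<in>G0 n k \<union> G1 n k. q ^ (2 * n + 1) * term_of q \<pi> * (if 2 * n - 1 \<notin> \<pi> then 1 + \<delta> n k else 1))"
    unfolding C1_def[of q "Suc n"] G1_Suc by (simp only: sum.reindex[OF inj] o_def tm cong: sum.cong)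
  also have "\<dots> = (\<Sum>\<pi>\<in>G0 n k. q ^ (2 * n + 1) * term_of q \<pi> * (1 + \<delta> n k))
      + (\<Sum>\<pi>\<in>G1 n k. q ^ (2 * n + 1) * term_of q \<pi>)"
    unfolding sum.union_disjoint[OF finite_G G_disjoint]
    by (intro arg_cong2[where f = "(+)"] sum.cong refl) (auto simp: G0_def G1_def)
  also have "\<dots> = q ^ (2 * n + 1) * (C1 q n k + C0 q n k * (1 + \<delta> n k))"
    by (simp add: C0_def C1_def sum_distrib_left sum_distrib_right algebra_simps sum.distrib)
  finally show ?thesis .
qed

lemma C1_zero: "C1 q n 0 = 0"
  by (simp add: C1_def G1_zero)

section \<open>The product side\<close>

text \<open>The elementary symmetric polynomial of degree \<open>k\<close> in the first
  \<open>n\<close> odd powers of \<open>q\<close>.\<close>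

definition e :: "'a::comm_ring_1 \<Rightarrow> nat \<Rightarrow> nat \<Rightarrow> 'a" where
  "e q n k = (\<Sum>A | A \<subseteq> odds {..<2 * n} \<and> card A = k. q ^ \<Sum>A)"

text \<open>The expanded product of \<open>1 + q ^ (4 * j)\<close> over \<open>1 \<le> j\<close> and
  \<open>2 * j \<le> N\<close>; kept as a sum over sets so that its terms are partitions into
  distinct multiples of 4.\<close>

definition P :: "'a::comm_ring_1 \<Rightarrow> nat \<Rightarrow> 'a" where
  "P q N = (\<Sum>E\<in>Pow {b. 0 < b \<and> b \<le> 2 * N \<and> 4 dvd b}. q ^ \<Sum>E)"

lemma odds_lessThan_Suc: "odds {..<2 * Suc n} = insert (2 * n + 1) (odds {..<2 * n})"
  by (auto simp: odds_def less_Suc_eq)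

lemma e_zero [simp]: "e q n 0 = 1"
proof -
  have "{A. A \<subseteq> odds {..<2 * n} \<and> card A = 0} = {{}}"
    by (auto simp: card_eq_0_iff dest: finite_subset[OF _ finite_odds[of "{..<2 * n}"], simplified])
  then show ?thesis by (simp add: e_def)
qed

lemma e_0_Suc [simp]: "e q 0 (Suc k) = 0"
proof -
  have "{A. A \<subseteq> odds {..<2 * 0} \<and> card A = Suc k} = {}" by (auto simp: odds_def)
  then show ?thesis by (simp only: e_def sum.empty)
qed

lemma e_Suc_Suc: "e q (Suc n) (Suc k) = e q n (Suc k) + q ^ (2 * n + 1) * e q n k"
proof -
  let ?O = "odds {..<2 * n}" and ?a = "2 * n + 1"
  have fin: "finite A" "?a \<notin> A" if "A \<subseteq> ?O" for A
    using finite_subset[OF that] that by (auto simp: odds_def)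
  have split: "{A. A \<subseteq> insert ?a ?O \<and> card A = Suc k} =
      {A. A \<subseteq> ?O \<and> card A = Suc k} \<union> insert ?a ` {A. A \<subseteq> ?O \<and> card A = k}" (is "?L = ?R1 \<union> ?R2")
  proof (intro equalityI subsetI)
    fix A assume A: "A \<in> ?L"
    show "A \<in> ?R1 \<union> ?R2"
    proof (cases "?a \<in> A")
      case True
      then have "A = insert ?a (A - {?a})" "A - {?a} \<subseteq> ?O" "card (A - {?a}) = k"
        using A by auto
      then show ?thesis by blast
    qed (use A in blast)
  next
    fix A assume "A \<in> ?R1 \<union> ?R2"
    then show "A \<in> ?L" using fin by (auto simp del: Suc_eq_plus1)
  qed
  have inj: "inj_on (insert ?a) {A. A \<subseteq> ?O \<and> card A = k}"
    using inj_on_insert by (rule inj_on_subset) (use fin in blast)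
  have fs: "finite {A. A \<subseteq> ?O \<and> card A = j}" for j
    by (rule finite_subset[of _ "Pow ?O"]) auto
  have dj: "?R1 \<inter> ?R2 = {}" using fin by blast
  have "e q (Suc n) (Suc k) = e q n (Suc k) + (\<Sum>A | A \<subseteq> ?O \<and> card A = k. q ^ \<Sum>(insert ?a A))"
    unfolding e_def odds_lessThan_Suc split
      sum.union_disjoint[OF fs finite_imageI[OF fs] dj] sum.reindex[OF inj] o_def ..
  also have "(\<Sum>A | A \<subseteq> ?O \<and> card A = k. q ^ \<Sum>(insert ?a A)) = q ^ ?a * e q n k"
    unfolding e_def sum_distrib_left using fin by (intro sum.cong refl) (auto simp: power_add)
  finally show ?thesis .
qed

lemma e_eq_0: "n < k \<Longrightarrow> e q n k = 0"
proof (induction n arbitrary: k)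
  case 0 then show ?case by (cases k) auto
next
  case (Suc n) then show ?case by (cases k) (auto simp: e_Suc_Suc)
qed

lemma P_Suc: "P q (Suc N) = P q N * (1 + (if even (Suc N) then q ^ (2 * Suc N) else 0))"
proof (cases "even (Suc N)")
  case False
  have "{b. 0 < b \<and> b \<le> 2 * Suc N \<and> 4 dvd b} = {b. 0 < b \<and> b \<le> 2 * N \<and> 4 dvd b}"
    using False by (auto simp: le_Suc_eq) presburger+
  then show ?thesis using False by (simp add: P_def)
next
  case True
  let ?M = "{b. 0 < b \<and> b \<le> 2 * N \<and> 4 dvd b}" and ?c = "2 * Suc N"
  have M: "{b. 0 < b \<and> b \<le> 2 * Suc N \<and> 4 dvd b} = insert ?c ?M"
    using True by (auto simp: le_Suc_eq) presburger+
  have fM: "finite ?M" by (rule finite_subset[of _ "{..2 * N}"]) auto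
  have E: "finite E" "?c \<notin> E" if "E \<in> Pow ?M" for E
    using finite_subset[OF _ fM, of E] that by auto
  have inj: "inj_on (insert ?c) (Pow ?M)"
    using inj_on_insert by (rule inj_on_subset) (use E in blast)
  have dj: "Pow ?M \<inter> insert ?c ` Pow ?M = {}" using E by blast
  have "P q (Suc N) = P q N + (\<Sum>E\<in>Pow ?M. q ^ \<Sum>(insert ?c E))"
    unfolding P_def M Pow_insert using fM
    by (simp add: sum.union_disjoint dj sum.reindex[OF inj] del: mult_Suc_right Pow_iff)
  also have "(\<Sum>E\<in>Pow ?M. q ^ \<Sum>(insert ?c E)) = P q N * q ^ ?c"
    unfolding P_def sum_distrib_right using E
    by (intro sum.cong refl) (auto simp: power_add ac_simps)
  finally show ?thesis using True by (simp add: algebra_simps)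
qed

lemma P_0 [simp]: "P q 0 = 1"
proof -
  have "{b::nat. 0 < b \<and> b \<le> 2 * 0 \<and> 4 dvd b} = {}" by auto
  then show ?thesis by (simp only: P_def Pow_empty) simp
qed

text \<open>In terms of Gaussian binomials, \<open>e q n k = q ^ (k * k) [n choose k]\<close> in base \<open>q\<^sup>2\<close>;
  this is the absorption identity, stated without division.\<close>

lemma e_absorb:
  "(1 - q ^ (2 * k + 2)) * e q (Suc n) (Suc k) = q ^ (2 * k + 1) * (1 - q ^ (2 * n + 2)) * e q n k"
proof (induction n arbitrary: k)
  case 0
  then show ?case by (cases k) (auto simp: e_Suc_Suc algebra_simps)
next
  case (Suc n)
  \<comment> \<open>A companion identity changing only the upper index, obtained from the induction
    hypothesis at \<open>k - 1\<close> and the recursion for \<open>e\<close>.\<close>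
  have upper: "(1 - q ^ (2 * n + 2)) * e q n k = (1 - q ^ (2 * (n + 1 - k))) * e q (Suc n) k"
    if "k \<le> Suc n"
  proof (cases k)
    case (Suc j)
    define d where "d = n - j"
    have n: "n = j + d" using that Suc by (simp add: d_def)
    have "q ^ (2 * n + 2) = q ^ (2 * d) * q ^ (2 * j + 2)"
      "q ^ (2 * n + 1) = q ^ (2 * d) * q ^ (2 * j + 1)"
      unfolding power_add[symmetric] by (rule arg_cong[where f = "\<lambda>i. q ^ i"], simp add: n)+
    moreover have "(1 - X) * E = (1 - D) * E'"
      if "X = D * U" "Y = D * V" "E' = E + Y * F" "(1 - U) * E' = V * (1 - X) * F"
      for X Y D U V E E' F :: 'a
    proof -
      have "(1 - X) * E - (1 - D) * E' = D * ((1 - U) * E' - V * (1 - X) * F)"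
        unfolding that(1-3) by (simp add: algebra_simps)
      then show ?thesis unfolding that(4) by simp
    qed
    ultimately have "(1 - q ^ (2 * n + 2)) * e q n (Suc j) = (1 - q ^ (2 * d)) * e q (Suc n) (Suc j)"
      using Suc.IH[of j] e_Suc_Suc[of q n j] by blast
    then show ?thesis using Suc by (simp add: d_def)
  qed simp
  show ?case
  proof (cases "k \<le> Suc n")
    case True
    \<comment> \<open>Split \<open>e\<close> by its recursion, rewrite the first summand by the
      induction hypothesis and \<open>upper\<close>, and collect the powers using
      \<open>n + 1 = k + d\<close>.\<close>
    define d where "d = n + 1 - k"
    have n: "n + 1 = k + d" using True by (simp add: d_def)
    have p: "q ^ (2 * n + 3) = q ^ (2 * k + 1) * q ^ (2 * d)"
      "q ^ (2 * Suc n + 2) = q ^ (2 * k + 2) * q ^ (2 * d)"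
      unfolding power_add[symmetric]
      by (rule arg_cong[where f = "\<lambda>i. q ^ i"], use n in simp)+
    have "(1 - q ^ (2 * k + 2)) * e q (Suc (Suc n)) (Suc k) =
        (1 - q ^ (2 * k + 2)) * e q (Suc n) (Suc k)
        + (1 - q ^ (2 * k + 2)) * (q ^ (2 * n + 3) * e q (Suc n) k)"
      by (simp add: e_Suc_Suc[of q "Suc n"] distrib_left numeral_3_eq_3)
    also have "(1 - q ^ (2 * k + 2)) * e q (Suc n) (Suc k) =
        q ^ (2 * k + 1) * ((1 - q ^ (2 * d)) * e q (Suc n) k)"
      unfolding Suc.IH using upper[OF True] by (simp add: d_def mult.assoc)
    finally show ?thesis unfolding p by (simp add: algebra_simps)
  qed (simp add: e_eq_0)
qed

section \<open>Solving the recurrences\<close>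

text \<open>\<open>Suc n - k\<close> and \<open>Suc n + k\<close> have the same parity, so \<delta>
  detects exactly whether the new level \<open>2 * (Suc n - k)\<close> is a multiple of 4.\<close>

lemma P_step:
  assumes "k \<le> n"
  shows "P q (Suc n - k) = P q (n - k) * (1 + \<delta> (Suc n) k * q ^ (2 * (Suc n - k)))"
  using assms P_Suc[of q "n - k"] by (simp add: \<delta>_def Suc_diff_le)

text \<open>The formula for \<open>C1\<close> is what \<open>C0_Suc\<close> forces once
  \<open>C0\<close> has the product form, so the \<open>C0\<close> half of the induction telescopes.
  The content is that it also satisfies \<open>C1_Suc_Suc\<close>, which reduces to
  \<open>e_absorb\<close>. For \<open>k > n\<close> truncation makes \<open>P q (n - k)\<close>
  equal to 1, and \<open>e q n k\<close> vanishes.\<close>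

lemma C_closed:
  "C0 q (Suc n) k = P q (n - k) * e q n k \<and>
   C1 q (Suc n) k = P q (Suc n - k) * e q (Suc n) k
     - (1 + \<delta> (Suc n) k * q ^ (2 * Suc n)) * P q (n - k) * e q n k"
proof (induction n arbitrary: k)
  case 0
  have C: "C0 q 0 k = (if k = 0 then 1 else 0)" "C1 q 0 k = 0" for k
    by (auto simp: C0_def C1_def G_0 term_of_def starts_def)
  have d: "\<delta> 0 k = (0::'a)" for k by (simp add: \<delta>_def)
  show ?case
  proof (cases k)
    case 0
    then show ?thesis by (simp add: C0_Suc C1_zero C d P_Suc \<delta>_def)
  next
    case (Suc j)
    then show ?thesis by (cases j) (simp_all add: C0_Suc C1_Suc_Suc C d e_Suc_Suc)
  qed
next
  case (Suc n)
  have C0: "C0 q (Suc (Suc n)) k = P q (Suc n - k) * e q (Suc n) k"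
    unfolding C0_Suc[of q "Suc n"] Suc.IH[THEN conjunct1] Suc.IH[THEN conjunct2]
    by (simp add: algebra_simps)
  have "C1 q (Suc (Suc n)) k = P q (Suc (Suc n) - k) * e q (Suc (Suc n)) k
     - (1 + \<delta> (Suc (Suc n)) k * q ^ (2 * Suc (Suc n))) * P q (Suc n - k) * e q (Suc n) k"
  proof (cases k)
    case 0
    then show ?thesis using P_step[of 0 "Suc n" q] by (simp add: C1_zero algebra_simps)
  next
    case (Suc j)
    let ?d = "\<delta> (Suc n) j :: 'a"
    have d: "\<delta> (Suc (Suc n)) (Suc j) = ?d" by (simp add: \<delta>_def)
    \<comment> \<open>The two recurrences use \<open>1 + \<delta>\<close> and
      \<open>1 + \<delta> * q ^ (2 * n + 2)\<close> respectively; their difference leaves the factor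
      \<open>1 - q ^ (2 * n + 2)\<close> needed for absorption.\<close>
    have C1: "C1 q (Suc (Suc n)) (Suc j) = q ^ (2 * n + 3) *
        (P q (Suc n - j) * e q (Suc n) j + ?d * (1 - q ^ (2 * n + 2)) * P q (n - j) * e q n j)"
      unfolding C1_Suc_Suc[of q "Suc n"] Suc.IH[THEN conjunct1] Suc.IH[THEN conjunct2]
      by (simp add: algebra_simps numeral_3_eq_3)
    show ?thesis
    proof (cases "j \<le> n")
      case False
      then have "P q (Suc n - j) = 1" by simp
      then show ?thesis using False Suc unfolding Suc C1
        by (simp add: e_Suc_Suc[of q "Suc n"] e_eq_0 numeral_3_eq_3)
    next
      case True
      define m where "m = Suc n - j"
      have "q ^ (2 * n + 3) = q ^ (2 * m) * q ^ (2 * j + 1)"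
        "q ^ (2 * Suc (Suc n)) = q ^ (2 * m) * q ^ (2 * j + 2)"
        unfolding power_add[symmetric]
        by (rule arg_cong[where f = "\<lambda>i. q ^ i"], use True in \<open>simp add: m_def\<close>)+
      moreover have "e q (Suc (Suc n)) (Suc j) = e q (Suc n) (Suc j) + q ^ (2 * n + 3) * e q (Suc n) j"
        by (simp add: e_Suc_Suc[of q "Suc n"] numeral_3_eq_3)
      moreover have "P q (Suc n - j) = P q (n - j) * (1 + ?d * q ^ (2 * m))"
        using P_step[OF True] by (simp add: m_def)
      \<comment> \<open>Again with letters for the powers: the difference of the two sides is
        \<open>- d * P * M\<close> times the difference of the sides of
        \<open>e_absorb\<close>.\<close>
      moreover have "Y * (P' * F' + d * (1 - X) * P * F) = P' * E' - (1 + d * Z) * P * E"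
        if "Y = M * V" "Z = M * U" "E' = E + Y * F'" "P' = P * (1 + d * M)"
          "(1 - U) * E = V * (1 - X) * F"
        for X Y Z M U V E E' F F' P P' d :: 'a
      proof -
        have "Y * (P' * F' + d * (1 - X) * P * F) - (P' * E' - (1 + d * Z) * P * E) =
            - d * P * M * ((1 - U) * E - V * (1 - X) * F)"
          unfolding that(1-4) by (simp add: algebra_simps)
        then show ?thesis unfolding that(5) by simp
      qed
      ultimately show ?thesis unfolding Suc C1 d diff_Suc_Suc using e_absorb[of q j n] by blast
    qed
  qed
  with C0 show ?case by simp
qed

section \<open>Comparing coefficients\<close>

text \<open>The partitions counted by \<open>Q2\<close>, sorted by the number of odd parts, with
  separate bounds on odd and even parts to match the factors \<open>e q n k\<close> and
  \<open>P q N\<close>.\<close>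

definition R :: "nat \<Rightarrow> nat \<Rightarrow> nat \<Rightarrow> nat set set" where
  "R N n k = {\<pi>. distinct_partition \<pi> \<and> (\<forall>a\<in>\<pi>. \<not> [a = 2] (mod 4)) \<and> card (odds \<pi>) = k \<and>
     (\<forall>a\<in>\<pi>. if odd a then a < 2 * n else a \<le> 2 * N)}"

lemma finite_R: "finite (R N n k)"
proof (rule finite_subset)
  show "R N n k \<subseteq> Pow {..2 * n + 2 * N}"
    by (force simp: R_def split: if_splits)
qed simp

lemma not_cong_2_mod_4: "\<not> [a = 2] (mod 4) \<longleftrightarrow> odd a \<or> 4 dvd a" for a :: nat
  by (simp add: cong_def) presburger

text \<open>Even parts not congruent to 2 modulo 4 are multiples of 4, so splitting a partition into
  its even and odd parts matches a term of each factor.\<close>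

lemma P_mult_e: "P q N * e q n k = (\<Sum>\<pi>\<in>R N n k. q ^ \<Sum>\<pi>)"
proof -
  let ?M = "{b. 0 < b \<and> b \<le> 2 * N \<and> 4 dvd b}" and ?O = "{A. A \<subseteq> odds {..<2 * n} \<and> card A = k}"
  have "P q N * e q n k = (\<Sum>E\<in>Pow ?M. \<Sum>A\<in>?O. q ^ \<Sum>E * q ^ \<Sum>A)"
    by (simp only: P_def e_def sum_product)
  also have "\<dots> = (\<Sum>(E, A)\<in>Pow ?M \<times> ?O. q ^ \<Sum>E * q ^ \<Sum>A)"
    by (rule sum.cartesian_product)
  also have "\<dots> = (\<Sum>\<pi>\<in>R N n k. q ^ \<Sum>\<pi>)"
  proof (rule sum.reindex_bij_witness[of _ "\<lambda>\<pi>. (\<pi> - odds \<pi>, odds \<pi>)" "\<lambda>(E, A). E \<union> A"])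
    fix p assume "p \<in> Pow ?M \<times> ?O"
    then obtain E A where p: "p = (E, A)" "E \<subseteq> ?M" "A \<subseteq> odds {..<2 * n}" "card A = k" by auto
    have ev: "even b" if "b \<in> E" for b
      using that p(2) dvd_trans[of 2 4 b] by auto
    have od: "odd b" if "b \<in> A" for b
      using that p(3) by (auto simp: odds_def)
    have fin: "finite E" "finite A"
      using p(2) finite_subset[of E "{..2 * N}"] finite_subset[OF p(3)] by auto
    have oA: "odds (E \<union> A) = A" using ev od by (auto simp: odds_def)
    have dj: "E \<inter> A = {}" using ev od by auto
    show "(\<lambda>\<pi>. (\<pi> - odds \<pi>, odds \<pi>)) (case p of (E, A) \<Rightarrow> E \<union> A) = p"
      using oA dj p(1) by auto
    show "(case p of (E, A) \<Rightarrow> E \<union> A) \<in> R N n k"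
      using fin p ev od oA
      by (auto simp: R_def distinct_partition_def not_cong_2_mod_4 odds_def)
    show "q ^ \<Sum>(case p of (E, A) \<Rightarrow> E \<union> A) = (case p of (E, A) \<Rightarrow> q ^ \<Sum>E * q ^ \<Sum>A)"
      using fin dj p(1) by (simp add: sum.union_disjoint power_add)
  next
    fix \<pi> assume "\<pi> \<in> R N n k"
    then show "(case (\<pi> - odds \<pi>, odds \<pi>) of (E, A) \<Rightarrow> E \<union> A) = \<pi>"
      "(\<pi> - odds \<pi>, odds \<pi>) \<in> Pow ?M \<times> ?O"
      by (auto simp: R_def distinct_partition_def not_cong_2_mod_4 odds_def intro: gr0I)
  qed
  finally show ?thesis .
qed

section \<open>Bounds by the sum of the parts and extraction of coefficients\<close>

lemma mem_le_sigma: "finite \<pi> \<Longrightarrow> a \<in> \<pi> \<Longrightarrow> a \<le> \<Sum>\<pi>" for \<pi> :: "nat set"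
  using member_le_sum[of a \<pi> "\<lambda>x. x"] by simp

lemma card_odds_le_sigma:
  assumes "finite \<pi>" shows "card (odds \<pi>) \<le> \<Sum>\<pi>"
proof -
  have "card (odds \<pi>) = (\<Sum>a\<in>odds \<pi>. 1)" by simp
  also have "\<dots> \<le> \<Sum>(odds \<pi>)" by (rule sum_mono) (auto simp: odds_def elim: oddE)
  also have "\<dots> \<le> \<Sum>\<pi>" using assms by (intro sum_mono2) (auto simp: odds_def)
  finally show ?thesis .
qed

lemma coeff_generating:
  fixes f :: "nat set \<Rightarrow> nat"
  assumes "finite F"
  shows "coeff (\<Sum>\<pi>\<in>F. of_nat (f \<pi>) * monom 1 1 ^ \<Sum>\<pi>) m = int (\<Sum>\<pi> | \<pi> \<in> F \<and> \<Sum>\<pi> = m. f \<pi>)"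
proof -
  have "coeff (of_nat (f \<pi>) * monom (1::int) 1 ^ \<Sum>\<pi>) m = (if \<Sum>\<pi> = m then int (f \<pi>) else 0)" for \<pi>
    by (simp add: monom_power of_nat_poly smult_monom)
  then show ?thesis
    using assms by (simp add: coeff_sum sum.If_cases Int_def)
qed

text \<open>For \<open>n = 2 * m + 1\<close> the size restrictions in \<open>G0\<close> and \<open>R\<close> are implied by the sum being \<open>m\<close>.\<close>

lemma weighted_count_eq:
  assumes "k \<le> m"
  shows "(\<Sum>\<pi> | good \<pi> \<and> \<Sum>\<pi> = m \<and> card (odds \<pi>) = k. weight \<pi>) =
    card {\<pi>. distinct_partition \<pi> \<and> (\<forall>a\<in>\<pi>. \<not> [a = 2] (mod 4)) \<and> \<Sum>\<pi> = m \<and> card (odds \<pi>) = k}"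
    (is "?L = card ?R")
proof -
  define n where "n = 2 * m + 1"
  let ?x = "monom (1::int) 1"
  have "C0 ?x (Suc n) k = P ?x (n - k) * e ?x n k" using C_closed by blast
  then have "(\<Sum>\<pi>\<in>G0 (Suc n) k. of_nat (2 ^ card (starts \<pi>)) * ?x ^ \<Sum>\<pi>) =
      (\<Sum>\<pi>\<in>R (n - k) n k. of_nat 1 * ?x ^ \<Sum>\<pi>)"
    by (simp add: P_mult_e C0_def term_of_def)
  from arg_cong[where f = "\<lambda>p. coeff p m", OF this]
  have *: "(\<Sum>\<pi> | \<pi> \<in> G0 (Suc n) k \<and> \<Sum>\<pi> = m. 2 ^ card (starts \<pi>)) =
      (\<Sum>\<pi> | \<pi> \<in> R (n - k) n k \<and> \<Sum>\<pi> = m. 1::nat)"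
    by (simp only: coeff_generating finite_G finite_R of_nat_eq_iff)
  have "{\<pi>. \<pi> \<in> G0 (Suc n) k \<and> \<Sum>\<pi> = m} = {\<pi>. good \<pi> \<and> \<Sum>\<pi> = m \<and> card (odds \<pi>) = k}"
  proof (intro Collect_cong iffI)
    fix \<pi> assume g: "good \<pi> \<and> \<Sum>\<pi> = m \<and> card (odds \<pi>) = k"
    then have "a \<le> m" if "a \<in> \<pi>" for a using that mem_le_sigma by (auto simp: good_def)
    then have "2 * Suc n - 1 \<notin> \<pi>" "\<pi> \<subseteq> {..<2 * Suc n}"
      by (force simp: n_def)+
    then show "\<pi> \<in> G0 (Suc n) k \<and> \<Sum>\<pi> = m" using g by (simp add: G0_def)
  qed (simp add: G0_def)
  moreover have "{\<pi>. \<pi> \<in> R (n - k) n k \<and> \<Sum>\<pi> = m} = ?R"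
  proof (intro Collect_cong iffI)
    fix \<pi> assume g: "distinct_partition \<pi> \<and> (\<forall>a\<in>\<pi>. \<not> [a = 2] (mod 4)) \<and> \<Sum>\<pi> = m \<and> card (odds \<pi>) = k"
    then have "a \<le> m" if "a \<in> \<pi>" for a using that mem_le_sigma by (auto simp: distinct_partition_def)
    \<comment> \<open>Since \<open>k \<le> m\<close>, the bound \<open>2 * (n - k)\<close> is at
      least \<open>2 * m + 2\<close>, hence harmless for parts of size at most
      \<open>m\<close>.\<close>
    then have "\<forall>a\<in>\<pi>. if odd a then a < 2 * n else a \<le> 2 * (n - k)"
      using assms by (force simp: n_def)
    then show "\<pi> \<in> R (n - k) n k \<and> \<Sum>\<pi> = m" using g by (simp add: R_def)
  qed (simp add: R_def)
  ultimately have "(\<Sum>\<pi> | good \<pi> \<and> \<Sum>\<pi> = m \<and> card (odds \<pi>) = k. 2 ^ card (starts \<pi>)) = card ?R"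
    using * by simp
  moreover have "?L = (\<Sum>\<pi> | good \<pi> \<and> \<Sum>\<pi> = m \<and> card (odds \<pi>) = k. 2 ^ card (starts \<pi>))"
    by (rule sum.cong) (auto simp: weight_eq good_def)
  ultimately show ?thesis by simp
qed

lemma finite_sigma: "finite {\<pi>. finite \<pi> \<and> \<Sum>\<pi> = (m::nat)}"
  by (rule finite_subset[of _ "Pow {..m}"]) (auto intro: mem_le_sigma)

theorem theorem3:
  fixes n :: nat
  shows "Q2 n = (\<Sum>\<pi> \<in> {\<pi> \<in> S. sigma \<pi> = n}. weight \<pi>)"
proof -
  let ?Q = "{\<pi>. distinct_partition \<pi> \<and> (\<forall>a\<in>\<pi>. \<not> [a = 2] (mod 4)) \<and> \<Sum>\<pi> = n}"
  let ?S = "{\<pi>. good \<pi> \<and> \<Sum>\<pi> = n}"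
  have fin: "finite ?Q" "finite ?S"
    by (rule finite_subset[OF _ finite_sigma[of n]], force simp: distinct_partition_def good_def)+
  have im: "(\<lambda>\<pi>. card (odds \<pi>)) ` ?Q \<subseteq> {..n}" "(\<lambda>\<pi>. card (odds \<pi>)) ` ?S \<subseteq> {..n}"
    using card_odds_le_sigma by (auto simp: distinct_partition_def good_def)
  have "(\<Sum>\<pi>\<in>{\<pi> \<in> S. \<Sum>\<pi> = n}. weight \<pi>) = (\<Sum>\<pi>\<in>?S. weight \<pi>)"
    by (simp add: S_eq)
  \<comment> \<open>Sort both sides by the number of odd parts, at most \<open>n\<close> because
    each such part is at least 1; the identity holds for each \<open>k\<close> separately.\<close>
  also have "\<dots> = (\<Sum>k\<le>n. \<Sum>\<pi> | \<pi> \<in> ?S \<and> card (odds \<pi>) = k. weight \<pi>)"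
    by (rule sum.group[symmetric, OF fin(2) _ im(2)]) simp
  also have "\<dots> = (\<Sum>k\<le>n. \<Sum>\<pi> | \<pi> \<in> ?Q \<and> card (odds \<pi>) = k. 1)"
  proof (rule sum.cong[OF refl])
    fix k assume "k \<in> {..n}"
    then show "(\<Sum>\<pi> | \<pi> \<in> ?S \<and> card (odds \<pi>) = k. weight \<pi>) =
        (\<Sum>\<pi> | \<pi> \<in> ?Q \<and> card (odds \<pi>) = k. 1)"
      using weighted_count_eq[of k n] by (simp add: conj_assoc)
  qed
  also have "\<dots> = (\<Sum>\<pi>\<in>?Q. 1)"
    by (rule sum.group[OF fin(1) _ im(1)]) simp
  finally show ?thesis by (simp add: Q2_def)
qed

end
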